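(* Let $p\ge1$. Each connected component of the quotient $\mathcal S_{0,3}(p)/\mathrm U(p)$ (quotient topology, action by simultaneous conjugation) is contractible.
   Context: $\mathrm U(p)$ is the group of unitary $p\times p$ complex matrices and $\mathcal E_p=\{A\in\mathrm U(p):\det(A-I_p)\neq0\}$. Let $\Sigma_{0,3}$ be the three-holed sphere, with $\pi_1(\Sigma_{0,3})=\langle c_1,c_2,c_3\mid c_1c_2c_3=1\rangle$, where the $c_j$ are the boundary loops. Then $$\mathcal S_{0,3}(p)=\{\phi\in\mathrm{Hom}(\pi_1(\Sigma_{0,3}),\mathrm U(p)):\phi(c_j)\in\mathcal E_p,\ j=1,2,3\},$$ i.e. the space of triples $(C_1,C_2,C_3)\in\mathcal E_p^3$ with $C_1C_2C_3=I_p$, topologized as a subspace of $\mathrm U(p)^3$. The group $\mathrm U(p)$ acts by $U\cdot(C_1,C_2,C_3)=(UC_1U^*,UC_2U^*,UC_3U^* )$. *)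

theory Defs
  imports "HOL-Analysis.Analysis"
begin

definition conj_transpose :: "complex^'n^'m \<Rightarrow> complex^'m^'n"
  where "conj_transpose A = map_matrix cnj (transpose A)"

definition unitary_group :: "(complex^'p^'p) set"
  where "unitary_group = {A. A ** conj_transpose A = mat 1 \<and> conj_transpose A ** A = mat 1}"

definition E_set :: "(complex^'p^'p) set"
  where "E_set = {A \<in> unitary_group. det (A - mat 1) \<noteq> 0}"

text \<open>A representation of \<open>\<langle>c\<^sub>1, c\<^sub>2, c\<^sub>3 | c\<^sub>1 c\<^sub>2 c\<^sub>3 = 1\<rangle>\<close> is identified with the
  triple of images of the boundary loops \<open>c\<^sub>j\<close>.\<close>

definition S03 :: "((complex^'p^'p) \<times> (complex^'p^'p) \<times> (complex^'p^'p)) set"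
  where "S03 = {(C1, C2, C3).
    C1 \<in> E_set \<and> C2 \<in> E_set \<and> C3 \<in> E_set \<and> C1 ** C2 ** C3 = mat 1}"

definition conj_act :: "(complex^'p^'p) \<Rightarrow> (complex^'p^'p) \<times> (complex^'p^'p) \<times> (complex^'p^'p)
    \<Rightarrow> (complex^'p^'p) \<times> (complex^'p^'p) \<times> (complex^'p^'p)"
  where "conj_act U = (\<lambda>(C1, C2, C3).
    (U ** C1 ** conj_transpose U, U ** C2 ** conj_transpose U, U ** C3 ** conj_transpose U))"

definition conj_orbit :: "(complex^'p^'p) \<times> (complex^'p^'p) \<times> (complex^'p^'p)
    \<Rightarrow> ((complex^'p^'p) \<times> (complex^'p^'p) \<times> (complex^'p^'p)) set"
  where "conj_orbit x = (\<lambda>U. conj_act U x) ` unitary_group"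

definition quotient_topology :: "'a topology \<Rightarrow> ('a \<Rightarrow> 'b) \<Rightarrow> 'b topology"
  where "quotient_topology X q =
    topology (\<lambda>V. V \<subseteq> q ` topspace X \<and> openin X {x \<in> topspace X. q x \<in> V})"

lemma openin_quotient_topology:
  "openin (quotient_topology X q) V \<longleftrightarrow>
    V \<subseteq> q ` topspace X \<and> openin X {x \<in> topspace X. q x \<in> V}"
proof -
  have "istopology (\<lambda>V. V \<subseteq> q ` topspace X \<and> openin X {x \<in> topspace X. q x \<in> V})"
    unfolding istopology_def
  proof (intro conjI allI impI; (elim conjE)?)
    fix S T
    assume "openin X {x \<in> topspace X. q x \<in> S}" "openin X {x \<in> topspace X. q x \<in> T}"
    then have "openin X ({x \<in> topspace X. q x \<in> S} \<inter> {x \<in> topspace X. q x \<in> T})"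
      by (rule openin_Int)
    moreover have "{x \<in> topspace X. q x \<in> S} \<inter> {x \<in> topspace X. q x \<in> T} =
        {x \<in> topspace X. q x \<in> S \<inter> T}" by auto
    ultimately show "openin X {x \<in> topspace X. q x \<in> S \<inter> T}" by simp
  next
    fix \<K>
    assume K: "\<forall>K\<in>\<K>. K \<subseteq> q ` topspace X \<and> openin X {x \<in> topspace X. q x \<in> K}"
    then have "openin X (\<Union>K\<in>\<K>. {x \<in> topspace X. q x \<in> K})" by blast
    moreover have "(\<Union>K\<in>\<K>. {x \<in> topspace X. q x \<in> K}) = {x \<in> topspace X. q x \<in> \<Union>\<K>}"
      by auto
    ultimately show "openin X {x \<in> topspace X. q x \<in> \<Union>\<K>}" by simp
  qed blast+
  then show ?thesis
    by (simp add: quotient_topology_def)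
qed

lemma topspace_quotient_topology [simp]:
  "topspace (quotient_topology X q) = q ` topspace X"
proof
  show "topspace (quotient_topology X q) \<subseteq> q ` topspace X"
    using openin_topspace[of "quotient_topology X q"] unfolding openin_quotient_topology by simp
  have "{x \<in> topspace X. q x \<in> q ` topspace X} = topspace X" by auto
  then have "openin (quotient_topology X q) (q ` topspace X)"
    by (simp add: openin_quotient_topology)
  then show "q ` topspace X \<subseteq> topspace (quotient_topology X q)"
    by (rule openin_subset)
qed

lemma quotient_map_quotient_topology: "quotient_map X (quotient_topology X q) q"
  by (simp add: quotient_map_def openin_quotient_topology)

lemma conj_transpose_mult: "conj_transpose (A ** B) = conj_transpose B ** conj_transpose A"
  by (simp add: conj_transpose_def vec_eq_iff matrix_matrix_mult_def transpose_def mult.commute)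

lemma conj_transpose_conj_transpose [simp]: "conj_transpose (conj_transpose A) = A"
  by (simp add: conj_transpose_def vec_eq_iff transpose_def)

lemma matrix_diff_ldistrib: "A ** (B - C) = A ** B - A ** C" for A :: "complex^'n^'m"
  by (simp add: vec_eq_iff matrix_matrix_mult_def right_diff_distrib sum_subtractf)

lemma matrix_diff_rdistrib: "(A - B) ** C = A ** C - B ** C" for A :: "complex^'n^'m"
  by (simp add: vec_eq_iff matrix_matrix_mult_def left_diff_distrib sum_subtractf)

lemma conj_act_in_S03:
  assumes U: "U \<in> unitary_group" and x: "x \<in> S03"
  shows "conj_act U x \<in> S03"
proof -
  let ?V = "conj_transpose U"
  have UV: "U ** ?V = mat 1" and VU: "?V ** U = mat 1"
    using U by (auto simp: unitary_group_def)
  have cancel: "A ** ?V ** U = A" "A ** U ** ?V = A" for A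
    by (simp_all add: UV VU flip: matrix_mul_assoc)
  have E: "U ** C ** ?V \<in> E_set" if C: "C \<in> E_set" for C
  proof -
    have CC: "C ** conj_transpose C = mat 1" "conj_transpose C ** C = mat 1"
      using C by (auto simp: E_set_def unitary_group_def)
    have cancelC: "A ** C ** conj_transpose C = A" "A ** conj_transpose C ** C = A" for A
      by (simp_all add: CC flip: matrix_mul_assoc)
    have "U ** C ** ?V \<in> unitary_group"
      by (simp add: unitary_group_def conj_transpose_mult matrix_mul_assoc cancel cancelC UV)
    moreover have "U ** C ** ?V - mat 1 = U ** (C - mat 1) ** ?V"
      by (simp add: matrix_diff_ldistrib matrix_diff_rdistrib UV)
    moreover have "det U * det ?V = 1"
      using UV by (metis det_I det_mul)
    ultimately show ?thesis
      using C by (auto simp: E_set_def det_mul)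
  qed
  obtain C1 C2 C3 where xeq: "x = (C1, C2, C3)" by (cases x)
  have "U ** C1 ** ?V ** (U ** C2 ** ?V) ** (U ** C3 ** ?V) = U ** (C1 ** C2 ** C3) ** ?V"
    by (simp add: matrix_mul_assoc cancel)
  then show ?thesis
    using x E by (auto simp: xeq S03_def conj_act_def UV)
qed

text \<open>The points of the quotient by \<open>U(p)\<close> are the orbits themselves.\<close>

definition S03_mod_U ::
    "((complex^'p^'p) \<times> (complex^'p^'p) \<times> (complex^'p^'p)) set topology"
  where "S03_mod_U = quotient_topology (top_of_set S03) conj_orbit"

end

theory Submission
  imports Defs
begin

text \<open>The Cayley transform turns the three conditions into linear algebra. A unitary matrix \<open>C\<close>
  without eigenvalue 1 is \<open>1 - (1/2 + A)\<inverse>\<close> for exactly one skew-Hermitian \<open>A\<close>. If \<open>A\<close> and \<open>B\<close>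
  belong to \<open>C\<^sub>1\<close> and \<open>C\<^sub>2\<close>, then \<open>1 - C\<^sub>1 C\<^sub>2 = (1/2 + A)\<inverse> (A + B) (1/2 + B)\<inverse>\<close>, so the third
  matrix \<open>(C\<^sub>1 C\<^sub>2)\<inverse>\<close> avoids the eigenvalue 1 exactly when \<open>N = A + B\<close> is invertible. Triples thus
  correspond, compatibly with conjugation, to pairs \<open>(A, N)\<close> of skew-Hermitian matrices with \<open>N\<close>
  invertible (\<open>triple_of_in_S03\<close>, \<open>S03_params\<close>).

  The factor \<open>A\<close> is scaled to 0. The matrix \<open>N\<close> has a polar decomposition \<open>N = J P\<close> with \<open>P\<close>
  positive definite and \<open>J\<close> skew-Hermitian with \<open>J\<^sup>2 = - 1\<close>, and the segment from \<open>N\<close> to \<open>J\<close>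
  consists of invertible matrices. Existence of \<open>J\<close> comes from unitary diagonalization; its
  continuity in \<open>N\<close> from uniqueness, which makes the graph closed over the compact unitary group.
  The straight-line deformation \<open>(A, N) \<mapsto> (0, J)\<close> commutes with conjugation and so descends to the
  quotient.

  Finally, \<open>J\<close> is determined up to unitary conjugation by the multiplicity of its eigenvalue \<open>\<i>\<close>,
  that is, by its trace. This trace depends continuously on the triple and takes finitely many
  values, so it is constant on each component of the quotient, and the deformation contracts the
  component to a single orbit (\<open>contractible_component_of_quotient\<close>).\<close>

section \<open>Matrix algebra\<close>

lemma conj_transpose_add: "conj_transpose (A + B) = conj_transpose A + conj_transpose B"
  and conj_transpose_diff: "conj_transpose (A - B) = conj_transpose A - conj_transpose B"
  and conj_transpose_minus: "conj_transpose (- A) = - conj_transpose A"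
  and conj_transpose_scaleR: "conj_transpose (r *\<^sub>R A) = r *\<^sub>R conj_transpose A"
  by (simp_all add: conj_transpose_def transpose_def vec_eq_iff)

lemma conj_transpose_mat: "conj_transpose (mat c) = mat (cnj c)"
  by (auto simp: conj_transpose_def transpose_def vec_eq_iff mat_def)

lemmas conj_transpose_simps =
  conj_transpose_add conj_transpose_diff conj_transpose_minus conj_transpose_scaleR
  conj_transpose_mat conj_transpose_mult

lemma
  fixes A :: "complex^'n^'m"
  shows matrix_mult_minus_left: "(- A) ** B = - (A ** B)"
    and matrix_mult_minus_right: "A ** (- B) = - (A ** B)"
    and matrix_mult_scaleR_left: "(r *\<^sub>R A) ** B = r *\<^sub>R (A ** B)"
    and matrix_mult_add_rdistrib: "(A + C) ** B = A ** B + C ** B"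
    and matrix_mult_scaleR_right: "A ** (r *\<^sub>R B) = r *\<^sub>R (A ** B)"
  by (simp_all add: vec_eq_iff matrix_matrix_mult_def sum_negf scaleR_sum_right
      distrib_right sum.distrib)

lemmas matrix_ring_simps =
  matrix_add_ldistrib matrix_mult_add_rdistrib matrix_diff_ldistrib matrix_diff_rdistrib
  matrix_mult_minus_left matrix_mult_minus_right matrix_mult_scaleR_left
  matrix_mult_scaleR_right

lemma matrix_vector_minus: "(- A) *v x = - (A *v x)" for A :: "complex^'n^'m"
  by (simp add: vec_eq_iff matrix_vector_mult_def sum_negf)

lemma matrix_vector_scaleR: "(r *\<^sub>R A) *v x = r *\<^sub>R (A *v x)" for A :: "complex^'n^'m"
  by (simp add: vec_eq_iff matrix_vector_mult_def scaleR_sum_right)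

lemma matrix_vector_scaleR_right: "A *v (r *\<^sub>R x) = r *\<^sub>R (A *v x)"
  for A :: "complex^'n^'m"
  by (simp add: vec_eq_iff matrix_vector_mult_def scaleR_sum_right)

lemma continuous_on_matrix_mult [continuous_intros]:
  fixes f :: "'a::topological_space \<Rightarrow> complex^'n^'m" and g :: "'a \<Rightarrow> complex^'l^'n"
  assumes "continuous_on S f" "continuous_on S g"
  shows "continuous_on S (\<lambda>x. f x ** g x)"
  unfolding matrix_matrix_mult_def using assms by (intro continuous_intros)

lemma continuous_on_conj_transpose [continuous_intros]:
  assumes "continuous_on S f"
  shows "continuous_on S (\<lambda>x. conj_transpose (f x))"
  unfolding conj_transpose_def transpose_def map_matrix_def
  using assms by (auto intro!: continuous_intros)

lemma continuous_on_matrix_vector_mult [continuous_intros]: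
  fixes f :: "'a::topological_space \<Rightarrow> complex^'n^'m"
  assumes "continuous_on S f" "continuous_on S g"
  shows "continuous_on S (\<lambda>x. f x *v g x)"
  unfolding matrix_vector_mult_def using assms by (intro continuous_intros)

lemma continuous_on_trace [continuous_intros]:
  fixes f :: "'a::topological_space \<Rightarrow> complex^'n^'n"
  assumes "continuous_on S f"
  shows "continuous_on S (\<lambda>x. trace (f x))"
  unfolding trace_def using assms by (intro continuous_intros)

lemma continuous_on_det [continuous_intros]:
  fixes f :: "'a::topological_space \<Rightarrow> complex^'n^'n"
  assumes "continuous_on S f"
  shows "continuous_on S (\<lambda>x. det (f x))"
  unfolding det_def using assms by (intro continuous_intros)

lemma matrix_inv_unique:
  fixes A :: "complex^'n^'n"
  assumes "A ** B = mat 1"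
  shows "matrix_inv A = B"
proof -
  have BA: "B ** A = mat 1"
    using assms matrix_left_right_inverse by blast
  have "A ** matrix_inv A = mat 1 \<and> matrix_inv A ** A = mat 1"
    unfolding matrix_inv_def by (rule someI[of _ B]) (simp add: assms BA)
  then have "B ** (A ** matrix_inv A) = B"
    by simp
  then show ?thesis
    by (simp add: matrix_mul_assoc BA)
qed

lemma matrix_inv_mult:
  fixes A :: "complex^'n^'n"
  assumes "det A \<noteq> 0"
  shows "A ** matrix_inv A = mat 1" "matrix_inv A ** A = mat 1"
proof -
  obtain B where "A ** B = mat 1"
    using assms unfolding invertible_det_nz[symmetric] invertible_def by blast
  then show "A ** matrix_inv A = mat 1"
    using matrix_inv_unique by blast
  then show "matrix_inv A ** A = mat 1"
    using matrix_left_right_inverse by blast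
qed

lemma det_matrix_inv_nonzero:
  fixes A :: "complex^'n^'n"
  assumes "det A \<noteq> 0"
  shows "det (matrix_inv A) \<noteq> 0"
  by (metis assms det_I det_mul matrix_inv_mult(1) mult_zero_right zero_neq_one)

lemma det_uminus_nonzero_iff: "det (- A) \<noteq> 0 \<longleftrightarrow> det A \<noteq> 0" for A :: "complex^'n^'n"
proof -
  have "invertible A" if "invertible (- A)" for A :: "complex^'n^'n"
    using that unfolding invertible_def
    by (metis matrix_mult_minus_left matrix_mult_minus_right)
  from this[of A] this[of "- A"] show ?thesis
    by (auto simp: invertible_det_nz)
qed

lemma det_nonzero_if_kernel_trivial:
  fixes A :: "complex^'n^'n"
  assumes "\<And>x. A *v x = 0 \<Longrightarrow> x = 0"
  shows "det A \<noteq> 0"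
proof -
  obtain B where B: "B ** A = mat 1"
    using assms matrix_left_invertible_ker[of A] by blast
  then have "A ** B = mat 1"
    using matrix_left_right_inverse by blast
  with B show ?thesis
    unfolding invertible_det_nz[symmetric] invertible_def by blast
qed

lemma kernel_trivial_if_det_nonzero:
  fixes A :: "complex^'n^'n"
  assumes "det A \<noteq> 0" "A *v x = 0"
  shows "x = 0"
  using assms by (metis matrix_inv_mult(2) matrix_vector_mul_assoc matrix_vector_mul_lid
      matrix_vector_mult_0_right)

text \<open>Cramer's rule exhibits the entries of the inverse as quotients of polynomials in the
  entries.\<close>

lemma continuous_on_matrix_inv [continuous_intros]:
  fixes f :: "'a::topological_space \<Rightarrow> complex^'n^'n"
  assumes f: "continuous_on S f" and nz: "\<And>x. x \<in> S \<Longrightarrow> det (f x) \<noteq> 0"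
  shows "continuous_on S (\<lambda>x. matrix_inv (f x))"
proof -
  define g :: "'a \<Rightarrow> complex^'n^'n" where
    "g x = (\<chi> k l. det (\<chi> i j. if j = k then axis l 1 $ i else f x $ i $ j) / det (f x))" for x
  have "continuous_on S (\<lambda>x. if j = k then axis l 1 $ i else f x $ i $ j)" for i j k l
    using f by (cases "j = k") (auto intro!: continuous_intros)
  then have "continuous_on S g"
    unfolding g_def using f nz by (auto intro!: continuous_intros)
  moreover have "matrix_inv (f x) = g x" if "x \<in> S" for x
  proof -
    have "matrix_inv (f x) $ k $ l = g x $ k $ l" for k l
    proof -
      have "f x *v (matrix_inv (f x) *v axis l 1) = axis l 1"
        using nz[OF that] by (simp add: matrix_vector_mul_assoc matrix_inv_mult)
      then have "matrix_inv (f x) *v axis l 1 =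
        (\<chi> k. det (\<chi> i j. if j = k then axis l 1 $ i else f x $ i $ j) / det (f x))"
        using cramer[OF nz[OF that]] by blast
      then have "(matrix_inv (f x) *v axis l 1) $ k = g x $ k $ l"
        by (simp add: g_def)
      then show ?thesis
        by (simp add: matrix_vector_mult_def axis_def if_distrib[of "\<lambda>z. _ * z"] cong: if_cong)
    qed
    then show ?thesis
      by (simp add: vec_eq_iff)
  qed
  ultimately show ?thesis
    by (simp cong: continuous_on_cong)
qed

section \<open>The Hermitian inner product\<close>

text \<open>Conjugate-linear in the first argument. Its real part is the Euclidean inner product, which
  lets the real theory of self-adjoint maps be applied to complex matrices.\<close>

definition cip :: "complex^'n \<Rightarrow> complex^'n \<Rightarrow> complex"
  where "cip x y = (\<Sum>i\<in>UNIV. cnj (x $ i) * y $ i)"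

lemma inner_eq_Re_cip: "x \<bullet> y = Re (cip x y)"
  by (simp add: cip_def inner_vec_def inner_complex_def)

lemma cip_self: "cip x x = of_real (x \<bullet> x)"
  by (simp add: cip_def inner_vec_def inner_complex_def complex_eq_iff)

lemma cip_commute: "cip y x = cnj (cip x y)"
  by (simp add: cip_def mult.commute)

lemma cip_simps:
  "cip (- x) y = - cip x y" "cip x (- y) = - cip x y"
  "cip (c *s x) y = cnj c * cip x y" "cip x (c *s y) = c * cip x y"
  "cip x (r *\<^sub>R y) = of_real r * cip x y"
  "cip x (y + z) = cip x y + cip x z" "cip 0 y = 0" "cip x 0 = 0"
  by (simp_all add: cip_def sum_negf sum_distrib_left mult_ac distrib_left sum.distrib
      scaleR_conv_of_real[where 'a = complex])

lemma cip_adjoint: "cip x (A *v y) = cip (conj_transpose A *v x) y"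
proof -
  have "cip x (A *v y) = (\<Sum>i\<in>UNIV. \<Sum>j\<in>UNIV. cnj (x $ i) * (A $ i $ j * y $ j))"
    by (simp add: cip_def matrix_vector_mult_def sum_distrib_left)
  also have "\<dots> = (\<Sum>j\<in>UNIV. \<Sum>i\<in>UNIV. cnj (x $ i) * (A $ i $ j * y $ j))"
    by (rule sum.swap)
  also have "\<dots> = cip (conj_transpose A *v x) y"
    by (simp add: cip_def matrix_vector_mult_def conj_transpose_def transpose_def
        sum_distrib_left sum_distrib_right mult_ac)
  finally show ?thesis .
qed

lemma inner_adjoint: "x \<bullet> (A *v y) = (conj_transpose A *v x) \<bullet> y"
  by (simp add: inner_eq_Re_cip cip_adjoint)

lemma inner_skew_self:
  assumes "conj_transpose A = - A"
  shows "x \<bullet> (A *v x) = 0"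
  using inner_adjoint[of x A x] assms by (simp add: matrix_vector_minus inner_commute)

lemma conj_transpose_mult_entry:
  "(conj_transpose A ** B) $ a $ b = cip (column a A) (column b B)"
  by (simp add: matrix_matrix_mult_def conj_transpose_def transpose_def cip_def column_def)

section \<open>Unitary diagonalization\<close>

text \<open>A maximum of the quadratic form on the unit sphere of an invariant subspace is an
  eigenvector: the form \<open>l (x \<bullet> x) - x \<bullet> T x\<close> is then nonnegative on the subspace and vanishes at
  the maximum, so its derivative there vanishes in every direction of the subspace.\<close>

lemma self_adjoint_eigenvector:
  fixes T :: "'a::euclidean_space \<Rightarrow> 'a"
  assumes T: "linear T" and sa: "\<And>x y. x \<bullet> T y = T x \<bullet> y"
    and W: "subspace W" "\<And>x. x \<in> W \<Longrightarrow> T x \<in> W" and nz: "w \<in> W" "w \<noteq> 0"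
  obtains u l where "u \<in> W" "norm u = 1" "T u = l *\<^sub>R u"
proof -
  have "compact (sphere 0 1 \<inter> W)"
    using W(1) by (intro compact_Int_closed closed_subspace) auto
  moreover have "w /\<^sub>R norm w \<in> sphere 0 1 \<inter> W"
    using nz W(1) by (auto intro: subspace_scale)
  moreover have "continuous_on (sphere 0 1 \<inter> W) (\<lambda>x. x \<bullet> T x)"
    using T by (intro continuous_intros linear_continuous_on) (simp add: linear_linear)
  ultimately obtain u where u: "u \<in> sphere 0 1 \<inter> W"
    and max: "\<And>x. x \<in> sphere 0 1 \<inter> W \<Longrightarrow> x \<bullet> T x \<le> u \<bullet> T u"
    using continuous_attains_sup[of "sphere 0 1 \<inter> W" "\<lambda>x. x \<bullet> T x"] by blast
  define l where "l = u \<bullet> T u"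
  define Q where "Q x = l * (x \<bullet> x) - x \<bullet> T x" for x
  have uu: "u \<bullet> u = 1" "u \<in> W"
    using u by (auto simp: norm_eq_1)
  have Q0: "Q x \<ge> 0" if "x \<in> W" for x
  proof (cases "x = 0")
    case False
    define y where "y = x /\<^sub>R norm x"
    have "y \<in> sphere 0 1 \<inter> W"
      using False that W(1) by (auto simp: y_def intro: subspace_scale)
    then have "y \<bullet> T y \<le> l"
      using max l_def by blast
    moreover have "x = norm x *\<^sub>R y"
      using False by (simp add: y_def)
    then have "x \<bullet> T x = (norm x)\<^sup>2 * (y \<bullet> T y)"
      by (metis (no_types, lifting) T inner_scaleR_left inner_scaleR_right linear_cmul
          mult.assoc power2_eq_square)
    ultimately show ?thesis
      by (simp add: Q_def dot_square_norm mult.commute mult_right_mono)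
  qed (simp add: Q_def linear_0[OF T])
  define v where "v = l *\<^sub>R u - T u"
  have v: "v \<in> W"
    unfolding v_def using uu W by (intro subspace_diff subspace_scale) auto
  have expand: "Q (u + s *\<^sub>R v) = 2 * s * (v \<bullet> v) + s\<^sup>2 * Q v" for s
  proof -
    have "u \<bullet> T v = v \<bullet> T u"
      using sa[of u v] by (simp add: inner_commute)
    then have "Q (u + s *\<^sub>R v) =
        (l * (u \<bullet> u) - u \<bullet> T u) + 2 * s * (l * (u \<bullet> v) - v \<bullet> T u) + s\<^sup>2 * Q v"
      by (simp add: Q_def linear_add[OF T] linear_cmul[OF T] inner_add algebra_simps
          power2_eq_square inner_commute)
    moreover have "v \<bullet> v = l * (u \<bullet> v) - v \<bullet> T u"
      by (subst (2) v_def) (simp add: inner_diff inner_commute)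
    moreover have "l * (u \<bullet> u) = u \<bullet> T u"
      by (simp add: uu l_def)
    ultimately show ?thesis
      by simp
  qed
  have "v \<bullet> v = 0"
  proof (rule ccontr)
    assume "v \<bullet> v \<noteq> 0"
    then have pos: "v \<bullet> v > 0"
      by simp
    (* a step small enough for the linear term of the expansion to dominate the quadratic one *)
    define s where "s = - (v \<bullet> v) / (1 + Q v)"
    have den: "1 + Q v > 0"
      using Q0[OF v] by simp
    have "0 \<le> Q (u + s *\<^sub>R v)"
      using uu v W(1) by (intro Q0 subspace_add subspace_scale)
    also have "\<dots> \<le> 2 * s * (v \<bullet> v) + s\<^sup>2 * (1 + Q v)"
      by (simp add: expand mult_left_mono)
    also have "s\<^sup>2 * (1 + Q v) = - s * (v \<bullet> v)"
      using den by (simp add: s_def power2_eq_square)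
    finally have "0 \<le> s * (v \<bullet> v)"
      by simp
    moreover have "s < 0"
      using pos den by (simp add: s_def)
    ultimately show False
      using pos by (simp add: zero_le_mult_iff)
  qed
  then have "T u = l *\<^sub>R u"
    by (simp add: v_def)
  with u show ?thesis
    using that by (auto simp: norm_eq_1)
qed

text \<open>Multiplication by \<open>\<i>\<close> turns a skew-Hermitian matrix into a map that is self-adjoint for the
  real inner product; its real eigenvalues become imaginary ones.\<close>

lemma skew_eigenvector:
  fixes N :: "complex^'n^'n"
  assumes N: "conj_transpose N = - N" and W: "subspace W" "\<And>x. x \<in> W \<Longrightarrow> N *v x \<in> W"
    "\<And>x. x \<in> W \<Longrightarrow> \<i> *s x \<in> W" and nz: "w \<in> W" "w \<noteq> 0"
  obtains u l where "u \<in> W" "cip u u = 1" "N *v u = (\<i> * of_real l) *s u"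
proof -
  define T where "T x = \<i> *s (N *v x)" for x
  have "linear T"
    unfolding T_def by (rule linearI)
      (simp_all add: vec_eq_iff matrix_vector_right_distrib distrib_left
        matrix_vector_scaleR_right)
  moreover have "x \<bullet> T y = T x \<bullet> y" for x y
    by (simp add: T_def inner_eq_Re_cip cip_simps cip_adjoint[of x N y] N matrix_vector_minus)
  ultimately obtain u l where u: "u \<in> W" "norm u = 1" "T u = l *\<^sub>R u"
    using self_adjoint_eigenvector[of T W w] W nz unfolding T_def by blast
  have "N *v u = - (\<i> *s T u)"
    by (simp add: T_def vec_eq_iff)
  also have "\<dots> = (\<i> * of_real (- l)) *s u"
    unfolding u(3) by (simp add: vec_eq_iff scaleR_conv_of_real[where 'a = complex])
  finally have "N *v u = (\<i> * of_real (- l)) *s u" .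
  then show ?thesis
    using u by (intro that[of u "- l"]) (simp_all add: cip_self norm_eq_1)
qed

text \<open>Eigenvectors are split off one at a time; the orthogonal complement of those already found
  is invariant because the matrix is skew-Hermitian, and nonzero because a matrix with a zero row
  is singular.\<close>

lemma skew_orthonormal_eigenvectors:
  fixes N :: "complex^'n^'n"
  assumes N: "conj_transpose N = - N" and "finite (S :: 'n set)"
  shows "\<exists>v l. (\<forall>j\<in>S. N *v v j = (\<i> * of_real (l j)) *s v j) \<and>
    (\<forall>j\<in>S. \<forall>k\<in>S. cip (v j) (v k) = (if j = k then 1 else 0))"
  using \<open>finite S\<close>
proof induction
  case (insert a S)
  then obtain v l where ev: "\<And>j. j \<in> S \<Longrightarrow> N *v v j = (\<i> * of_real (l j :: real)) *s v j"
    and on: "\<And>j k. j \<in> S \<Longrightarrow> k \<in> S \<Longrightarrow> cip (v j) (v k) = (if j = k then 1 else 0)"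
    by blast
  define W where "W = {x. \<forall>k\<in>S. cip (v k) x = 0}"
  define M :: "complex^'n^'n" where "M = (\<chi> k j. if k \<in> S then cnj (v k $ j) else 0)"
  have "row a M = 0"
    using insert.hyps by (simp add: M_def row_def vec_eq_iff)
  then have "det M = 0"
    by (rule det_zero_row)
  then obtain w where w: "M *v w = 0" "w \<noteq> 0"
    using det_nonzero_if_kernel_trivial by blast
  have "cip (v k) w = (M *v w) $ k" if "k \<in> S" for k
    using that by (simp add: M_def matrix_vector_mult_def cip_def)
  then have "w \<in> W"
    by (simp add: W_def w)
  moreover have "subspace W"
    by (auto simp: subspace_def W_def cip_simps)
  moreover have "N *v x \<in> W" if "x \<in> W" for x
    using that by (auto simp: W_def cip_adjoint N matrix_vector_minus ev cip_simps)
  moreover have "\<i> *s x \<in> W" if "x \<in> W" for x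
    using that by (simp add: W_def cip_simps)
  ultimately obtain u m where u: "u \<in> W" "cip u u = 1" "N *v u = (\<i> * of_real m) *s u"
    using skew_eigenvector[OF N, of W w] w(2) by blast
  have "cip (v k) u = 0" "cip u (v k) = 0" if "k \<in> S" for k
    using u(1) that cip_commute[of u "v k"] by (auto simp: W_def)
  with u ev on insert.hyps show ?case
    by (intro exI[of _ "v(a := u)"] exI[of _ "l(a := m)"]) auto
qed simp

definition diagonal :: "('n \<Rightarrow> complex) \<Rightarrow> complex^'n^'n"
  where "diagonal d = (\<chi> i j. if i = j then d i else 0)"

lemma column_mult_diagonal: "column j (U ** diagonal d) = d j *s column j U"
  by (simp add: vec_eq_iff column_def matrix_matrix_mult_def diagonal_def
      if_distrib[of "\<lambda>z. _ * z"] mult.commute cong: if_cong)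

lemma column_mult: "column j (A ** B) = A *v column j B"
  by (simp add: vec_eq_iff column_def matrix_matrix_mult_def matrix_vector_mult_def)

lemma matrix_eq_if_columns_eq: "(\<And>j. column j A = column j B) \<Longrightarrow> A = B"
  by (simp add: vec_eq_iff column_def)

lemma unitary_if_orthonormal_columns:
  assumes "\<And>j k. cip (column j U) (column k U) = (if j = k then 1 else 0)"
  shows "U \<in> unitary_group"
proof -
  have "conj_transpose U ** U = mat 1"
    by (simp add: vec_eq_iff conj_transpose_mult_entry assms mat_def)
  then show ?thesis
    using matrix_left_right_inverse by (auto simp: unitary_group_def)
qed

lemma skew_diagonalization:
  fixes N :: "complex^'n^'n"
  assumes N: "conj_transpose N = - N"
  obtains U l where "U \<in> unitary_group" "N ** U = U ** diagonal (\<lambda>j. \<i> * of_real (l j))"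
proof -
  obtain v :: "'n \<Rightarrow> complex^'n" and l
    where ev: "\<And>j. N *v v j = (\<i> * of_real (l j :: real)) *s v j"
      and on: "\<And>j k. cip (v j) (v k) = (if j = k then 1 else 0)"
    using skew_orthonormal_eigenvectors[OF N, of UNIV] by auto
  define U :: "complex^'n^'n" where "U = (\<chi> i j. v j $ i)"
  have col: "column j U = v j" for j
    by (simp add: U_def column_def vec_eq_iff)
  show ?thesis
  proof (rule that[of U l])
    show "U \<in> unitary_group"
      by (rule unitary_if_orthonormal_columns) (simp add: col on)
    show "N ** U = U ** diagonal (\<lambda>j. \<i> * of_real (l j))"
      by (rule matrix_eq_if_columns_eq) (simp add: column_mult[of _ N U] column_mult_diagonal col ev)
  qed
qed

lemma diagonal_mult: "diagonal c ** diagonal d = diagonal (\<lambda>j. c j * d j)"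
  by (simp add: vec_eq_iff matrix_matrix_mult_def diagonal_def
      mult_delta_left)

lemma conj_transpose_diagonal: "conj_transpose (diagonal d) = diagonal (\<lambda>j. cnj (d j))"
  by (auto simp: vec_eq_iff conj_transpose_def transpose_def diagonal_def)

lemma minus_diagonal: "- diagonal d = diagonal (\<lambda>j. - d j)"
  by (simp add: vec_eq_iff diagonal_def)

lemma mat_eq_diagonal: "mat c = diagonal (\<lambda>j. c)"
  by (simp add: vec_eq_iff mat_def diagonal_def)

lemma diagonal_eq_iff: "diagonal c = diagonal d \<longleftrightarrow> (\<forall>j. c j = d j)"
  by (auto simp: vec_eq_iff diagonal_def)

section \<open>The unitary group\<close>

lemma unitary_cancel:
  assumes "U \<in> unitary_group"
  shows "A ** conj_transpose U ** U = A" "A ** U ** conj_transpose U = A"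
    "conj_transpose U ** U = mat 1" "U ** conj_transpose U = mat 1"
  using assms by (simp_all add: unitary_group_def flip: matrix_mul_assoc)

lemma unitary_group_mult:
  assumes U: "U \<in> unitary_group" and V: "V \<in> unitary_group"
  shows "U ** V \<in> unitary_group"
  unfolding unitary_group_def
  by (simp add: conj_transpose_mult matrix_mul_assoc unitary_cancel[OF U] unitary_cancel[OF V])

lemma unitary_group_conj_transpose: "U \<in> unitary_group \<Longrightarrow> conj_transpose U \<in> unitary_group"
  by (simp add: unitary_group_def)

lemma unitary_mult_eq_iff:
  assumes "U \<in> unitary_group"
  shows "A ** U = B \<longleftrightarrow> A = B ** conj_transpose U"
  by (auto simp: unitary_cancel[OF assms])

text \<open>The rows of a unitary matrix are unit vectors, which bounds the group.\<close>

lemma compact_unitary_group: "compact (unitary_group :: (complex^'n^'n) set)"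
proof -
  have "closed (unitary_group :: (complex^'n^'n) set)"
    unfolding unitary_group_def
    by (intro closed_Collect_conj closed_Collect_eq continuous_intros)
  moreover have "norm A \<le> real CARD('n)" if "A \<in> unitary_group" for A :: "complex^'n^'n"
  proof -
    have row_norm: "norm (A $ i) = 1" for i
    proof -
      have "cip (A $ i) (A $ i) = cnj ((A ** conj_transpose A) $ i $ i)"
        by (simp add: cip_def matrix_matrix_mult_def conj_transpose_def transpose_def)
      also have "\<dots> = 1"
        using unitary_cancel(4)[OF that] by (simp add: mat_def)
      finally show ?thesis
        by (simp add: cip_self norm_eq_1)
    qed
    have "norm A \<le> (\<Sum>i\<in>UNIV. norm (A $ i))"
      by (simp add: norm_vec_def L2_set_le_sum)
    then show ?thesis
      by (simp add: row_norm)
  qed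
  then have "bounded (unitary_group :: (complex^'n^'n) set)"
    unfolding bounded_iff by blast
  ultimately show ?thesis
    by (simp add: compact_eq_bounded_closed)
qed

section \<open>The unitary polar part of a skew-Hermitian matrix\<close>

text \<open>In terms of the polar decomposition \<open>N = J P\<close>, the last condition says that \<open>P = - J N\<close> is
  positive semidefinite. All conditions are closed in the pair \<open>(N, J)\<close>, as the closed-graph
  argument for continuity requires.\<close>

definition is_phase :: "complex^'n^'n \<Rightarrow> complex^'n^'n \<Rightarrow> bool"
  where "is_phase N J \<longleftrightarrow> conj_transpose J = - J \<and> J ** J = - mat 1 \<and> J ** N = N ** J \<and>
    (\<forall>x. x \<bullet> ((J ** N) *v x) \<le> 0)"

lemma is_phase_conjugate:
  assumes "is_phase N J" and U: "U \<in> unitary_group"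
  shows "is_phase (U ** N ** conj_transpose U) (U ** J ** conj_transpose U)"
proof -
  have prod: "(U ** A ** conj_transpose U) ** (U ** B ** conj_transpose U) =
      U ** (A ** B) ** conj_transpose U" for A B
    by (simp add: matrix_mul_assoc unitary_cancel[OF U])
  have "x \<bullet> ((U ** (J ** N) ** conj_transpose U) *v x) \<le> 0" for x
  proof -
    have "x \<bullet> ((U ** (J ** N) ** conj_transpose U) *v x) =
        (conj_transpose U *v x) \<bullet> ((J ** N) *v (conj_transpose U *v x))"
      by (simp add: inner_adjoint[of x U] flip: matrix_vector_mul_assoc)
    then show ?thesis
      using assms(1) unfolding is_phase_def by metis
  qed
  moreover have "conj_transpose (U ** J ** conj_transpose U) = - (U ** J ** conj_transpose U)"
    using assms by (simp add: is_phase_def conj_transpose_simps matrix_mul_assoc matrix_ring_simps)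
  moreover have "J ** J = - mat 1" "J ** N = N ** J"
    using assms by (simp_all add: is_phase_def)
  moreover have "U ** (- mat 1) ** conj_transpose U = - mat 1"
    by (simp add: matrix_ring_simps unitary_cancel[OF U])
  ultimately show ?thesis
    unfolding is_phase_def prod by simp
qed

text \<open>On a diagonal matrix with entries \<open>\<i> l\<^sub>j\<close> a phase is obtained by replacing each \<open>l\<^sub>j\<close> by its
  sign (with 0 counted as positive); diagonalization reduces the general case to this one.\<close>

lemma phase_exists:
  assumes N: "conj_transpose N = - N"
  shows "\<exists>J. is_phase N J"
proof -
  obtain U l where U: "U \<in> unitary_group"
    and NU: "N ** U = U ** diagonal (\<lambda>j. \<i> * of_real (l j))"
    using skew_diagonalization[OF N] .
  define D where "D = diagonal (\<lambda>j. \<i> * of_real (l j))"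
  define E where "E = diagonal (\<lambda>j. \<i> * of_real (if l j \<ge> 0 then 1 else - 1))"
  have "x \<bullet> ((E ** D) *v x) \<le> 0" for x
  proof -
    have ED: "E ** D = diagonal (\<lambda>j. - of_real \<bar>l j\<bar>)"
      by (auto simp: E_def D_def diagonal_mult diagonal_eq_iff)
    have "x \<bullet> ((E ** D) *v x) = (\<Sum>j\<in>UNIV. x $ j \<bullet> ((- \<bar>l j\<bar>) *\<^sub>R x $ j))"
      by (simp add: ED scaleR_conv_of_real[where 'a = complex] inner_vec_def matrix_vector_mult_def diagonal_def
          if_distrib[of "\<lambda>z. z * _"] cong: if_cong)
    also have "\<dots> \<le> 0"
      by (intro sum_nonpos) simp
    finally show ?thesis .
  qed
  then have "is_phase D E"
    by (auto simp: is_phase_def E_def D_def diagonal_mult diagonal_eq_iff conj_transpose_diagonal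
        minus_diagonal mat_eq_diagonal)
  then have "is_phase (U ** D ** conj_transpose U) (U ** E ** conj_transpose U)"
    by (rule is_phase_conjugate) (rule U)
  moreover have "N = U ** D ** conj_transpose U"
    using NU U by (simp add: unitary_mult_eq_iff D_def)
  ultimately show ?thesis
    by auto
qed

text \<open>The range of \<open>T\<close> is invariant, and self-adjointness makes it meet the kernel only in 0, so
  an eigenvector found in the range has a nonzero eigenvalue.\<close>

lemma self_adjoint_nonzero_eigenvector:
  fixes T :: "'a::euclidean_space \<Rightarrow> 'a"
  assumes T: "linear T" and sa: "\<And>x y. x \<bullet> T y = T x \<bullet> y" and nz: "T w \<noteq> 0"
  obtains u l where "u \<noteq> 0" "l \<noteq> 0" "T u = l *\<^sub>R u"
proof -
  have "subspace (range T)"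
    using T by (simp add: linear_subspace_image)
  then obtain u l where u: "u \<in> range T" "norm u = 1" "T u = l *\<^sub>R u"
    using self_adjoint_eigenvector[OF T sa, of "range T" "T w"] nz by blast
  then obtain y where y: "u = T y"
    by blast
  have "l \<noteq> 0"
  proof
    assume "l = 0"
    then have "u \<bullet> u = 0"
      using sa[of y u] u(3) y by simp
    with u(2) show False
      by simp
  qed
  with u show ?thesis
    by (intro that[of u l]) auto
qed

text \<open>Two phases give two positive semidefinite square roots of \<open>- N\<^sup>2\<close>, namely \<open>- J N\<close> and
  \<open>- J' N\<close>. Up to sign, \<open>D\<close> below is their difference and \<open>S\<close> their sum; these anticommute. An
  eigenvector of \<open>D\<close> with nonzero eigenvalue would be annihilated by the quadratic form of \<open>S\<close>,
  hence by the forms of both roots, hence by that of \<open>D\<close>, which is absurd.\<close>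

lemma phase_unique:
  fixes N :: "complex^'n^'n"
  assumes N: "conj_transpose N = - N" "det N \<noteq> 0" and J: "is_phase N J" "is_phase N J'"
  shows "J = J'"
proof -
  define D where "D = J ** N - J' ** N"
  define S where "S = J ** N + J' ** N"
  have sq: "(K ** N) ** (K ** N) = - (N ** N)" if "is_phase N K" for K
  proof -
    have "(K ** N) ** (K ** N) = (K ** K) ** (N ** N)"
      using that unfolding is_phase_def by (metis matrix_mul_assoc)
    then show ?thesis
      using that by (simp add: is_phase_def matrix_ring_simps)
  qed
  have anti: "D ** S = - (S ** D)"
    unfolding D_def S_def matrix_ring_simps using sq[OF J(1)] sq[OF J(2)] by simp
  have self: "conj_transpose (K ** N) = K ** N" if "is_phase N K" for K
    using that N by (simp add: is_phase_def conj_transpose_simps matrix_ring_simps)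
  then have D: "conj_transpose D = D"
    using J by (simp add: D_def conj_transpose_simps(2))
  have "D = 0"
  proof (rule ccontr)
    assume "D \<noteq> 0"
    then obtain w where "D *v w \<noteq> 0"
      by (metis matrix_eq matrix_vector_mult_0)
    moreover have "linear (\<lambda>x. D *v x)"
      by simp
    moreover have "x \<bullet> (D *v y) = (D *v x) \<bullet> y" for x y
      by (simp add: inner_adjoint D)
    ultimately obtain u l where u: "u \<noteq> 0" "l \<noteq> 0" "D *v u = l *\<^sub>R u"
      using self_adjoint_nonzero_eigenvector[of "\<lambda>x. D *v x"] by metis
    have "u \<bullet> ((D ** S) *v u) = l * (u \<bullet> (S *v u))"
      by (simp add: inner_adjoint[of u D] D u(3) flip: matrix_vector_mul_assoc)
    moreover have "u \<bullet> ((S ** D) *v u) = l * (u \<bullet> (S *v u))"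
      by (simp add: u(3) matrix_vector_scaleR_right flip: matrix_vector_mul_assoc)
    ultimately have "u \<bullet> (S *v u) = 0"
      using u(2) by (simp add: anti matrix_vector_minus)
    moreover have "u \<bullet> ((J ** N) *v u) \<le> 0" "u \<bullet> ((J' ** N) *v u) \<le> 0"
      using J by (auto simp: is_phase_def)
    ultimately have "u \<bullet> (D *v u) = 0"
      by (simp add: S_def D_def matrix_vector_mult_add_rdistrib matrix_vector_mult_diff_rdistrib
          inner_add_right inner_diff_right)
    with u show False
      by simp
  qed
  then have "J ** N = J' ** N"
    by (simp add: D_def)
  then show ?thesis
    by (metis N(2) matrix_inv_mult(1) matrix_mul_assoc matrix_mul_rid)
qed

definition phase :: "complex^'n^'n \<Rightarrow> complex^'n^'n"
  where "phase N = (THE J. is_phase N J)"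

definition invertible_skew :: "(complex^'n^'n) set"
  where "invertible_skew = {N. conj_transpose N = - N \<and> det N \<noteq> 0}"

lemma phase_eqI:
  assumes "N \<in> invertible_skew" "is_phase N J"
  shows "phase N = J"
  unfolding phase_def
proof (rule the_equality)
  fix K
  assume "is_phase N K"
  then show "K = J"
    using assms unfolding invertible_skew_def by (metis (mono_tags) mem_Collect_eq phase_unique)
qed (rule assms)

lemma is_phase_phase:
  assumes "N \<in> invertible_skew"
  shows "is_phase N (phase N)"
proof -
  obtain J where "is_phase N J"
    using phase_exists assms unfolding invertible_skew_def by blast
  then show ?thesis
    using phase_eqI[OF assms] by simp
qed

lemma is_phase_unitary: "is_phase N J \<Longrightarrow> J \<in> unitary_group"
  by (simp add: is_phase_def unitary_group_def matrix_ring_simps)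

lemma invertible_skew_conjugate:
  assumes "N \<in> invertible_skew" and U: "U \<in> unitary_group"
  shows "U ** N ** conj_transpose U \<in> invertible_skew"
proof -
  have "det U * det (conj_transpose U) = 1"
    by (metis unitary_cancel(4)[OF U] det_I det_mul)
  then show ?thesis
    using assms by (auto simp: invertible_skew_def conj_transpose_simps matrix_ring_simps
        matrix_mul_assoc det_mul)
qed

lemma phase_conjugate:
  "N \<in> invertible_skew \<Longrightarrow> U \<in> unitary_group \<Longrightarrow>
    phase (U ** N ** conj_transpose U) = U ** phase N ** conj_transpose U"
  by (rule phase_eqI[OF invertible_skew_conjugate is_phase_conjugate[OF is_phase_phase]])

text \<open>The phase takes values in a compact set and is the only solution of a closed condition, so
  its graph is closed and the map is continuous.\<close>

lemma continuous_on_phase: "continuous_on invertible_skew (phase :: complex^'n^'n \<Rightarrow> _)"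
proof -
  let ?T = "invertible_skew \<times> (unitary_group :: (complex^'n^'n) set)"
  have cont: "continuous_on UNIV (\<lambda>z :: (complex^'n^'n) \<times> (complex^'n^'n). x \<bullet> ((snd z ** fst z) *v x))"
    for x
    by (intro continuous_intros)
  have closed: "closed {z :: (complex^'n^'n) \<times> (complex^'n^'n). is_phase (fst z) (snd z)}"
    unfolding is_phase_def
    by (intro closed_Collect_conj closed_Collect_all closed_Collect_eq closed_Collect_le
        continuous_intros cont)
  have graph: "(\<lambda>N. (N, phase N)) ` invertible_skew =
      ?T \<inter> {z. is_phase (fst z) (snd z)}"
  proof (intro equalityI subsetI)
    fix z :: "(complex^'n^'n) \<times> (complex^'n^'n)"
    assume "z \<in> (\<lambda>N. (N, phase N)) ` invertible_skew"
    then show "z \<in> ?T \<inter> {z. is_phase (fst z) (snd z)}"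
      using is_phase_phase is_phase_unitary by auto
  next
    fix z :: "(complex^'n^'n) \<times> (complex^'n^'n)"
    assume "z \<in> ?T \<inter> {z. is_phase (fst z) (snd z)}"
    then have "fst z \<in> invertible_skew" "phase (fst z) = snd z"
      using phase_eqI by auto
    then show "z \<in> (\<lambda>N. (N, phase N)) ` invertible_skew"
      by (intro image_eqI[of _ _ "fst z"]) auto
  qed
  have clo: "closedin (top_of_set ?T) ((\<lambda>N. (N, phase N)) ` invertible_skew)"
    unfolding graph using closed by (rule closedin_closed_Int)
  have into: "phase \<in> invertible_skew \<rightarrow> (unitary_group :: (complex^'n^'n) set)"
    by (intro Pi_I is_phase_unitary[OF is_phase_phase])
  show ?thesis
    by (rule continuous_closed_graph_eq[OF compact_unitary_group into, THEN iffD2, OF clo])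
qed

text \<open>Multiplied by \<open>J\<close>, the point at time \<open>t\<close> becomes \<open>(1 - t) J N - t\<close>, which is negative
  definite for \<open>t > 0\<close>.\<close>

lemma segment_to_phase_invertible:
  fixes N :: "complex^'n^'n"
  assumes N: "N \<in> invertible_skew" and t: "0 \<le> t" "t \<le> 1"
  shows "(1 - t) *\<^sub>R N + t *\<^sub>R phase N \<in> invertible_skew"
proof -
  define J where "J = phase N"
  define M where "M = (1 - t) *\<^sub>R N + t *\<^sub>R J"
  have J: "is_phase N J"
    unfolding J_def using N by (rule is_phase_phase)
  have "x = 0" if "M *v x = 0" for x
  proof (cases "t = 0")
    case True
    then have "N *v x = 0"
      using that by (simp add: M_def)
    then show ?thesis
      using N kernel_trivial_if_det_nonzero unfolding invertible_skew_def by blast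
  next
    case False
    have "J ** M = (1 - t) *\<^sub>R (J ** N) - t *\<^sub>R mat 1"
      using J by (simp add: M_def matrix_ring_simps is_phase_def)
    then have "x \<bullet> ((J ** M) *v x) = (1 - t) * (x \<bullet> ((J ** N) *v x)) - t * (x \<bullet> x)"
      by (simp add: matrix_vector_mult_diff_rdistrib matrix_vector_scaleR inner_diff_right)
    moreover have "x \<bullet> ((J ** M) *v x) = 0"
      using that by (simp flip: matrix_vector_mul_assoc)
    moreover
    have "x \<bullet> ((J ** N) *v x) \<le> 0"
      using J unfolding is_phase_def by metis
    with t have "(1 - t) * (x \<bullet> ((J ** N) *v x)) \<le> 0"
      by (simp add: mult_nonneg_nonpos)
    ultimately have "t * (x \<bullet> x) \<le> 0"
      by linarith
    with False t have "x \<bullet> x \<le> 0"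
      by (simp add: mult_le_0_iff)
    then show ?thesis
      by (metis inner_eq_zero_iff inner_ge_zero order_antisym)
  qed
  then have "det M \<noteq> 0"
    by (rule det_nonzero_if_kernel_trivial)
  then show ?thesis
    using N J unfolding M_def J_def
    by (simp add: invertible_skew_def is_phase_def conj_transpose_simps)
qed

section \<open>Skew-Hermitian square roots of minus one up to conjugacy\<close>

text \<open>The eigenvalues are \<open>\<i>\<close> and \<open>- \<i>\<close>, so the trace counts how often each of them occurs.\<close>

lemma skew_unitary_diagonalization:
  fixes J :: "complex^'n^'n"
  assumes J: "conj_transpose J = - J" "J ** J = - mat 1"
  obtains U l where "U \<in> unitary_group" "J = U ** diagonal (\<lambda>j. \<i> * of_real (l j)) ** conj_transpose U"
    "\<And>j. l j = 1 \<or> l j = - 1" "trace J = \<i> * of_real (2 * real (card {j. l j = 1}) - CARD('n))"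
proof -
  obtain U l where U: "U \<in> unitary_group"
    and JU: "J ** U = U ** diagonal (\<lambda>j. \<i> * of_real (l j))"
    using skew_diagonalization[OF J(1)] .
  define D where "D = diagonal (\<lambda>j. \<i> * of_real (l j))"
  have JD: "J = U ** D ** conj_transpose U"
    using JU U by (simp add: unitary_mult_eq_iff D_def)
  have "conj_transpose U ** (J ** J) ** U = D ** D"
    by (simp add: JD matrix_mul_assoc unitary_cancel[OF U])
  then have "D ** D = - mat 1"
    by (simp add: J(2) matrix_ring_simps unitary_cancel[OF U])
  then have "\<i> * of_real (l j) * (\<i> * of_real (l j)) = (- 1 :: complex)" for j
    by (simp add: D_def diagonal_mult mat_eq_diagonal minus_diagonal diagonal_eq_iff)
  then have "l j * l j = 1" for j
    by (simp add: complex_eq_iff)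
  then have l: "l j = 1 \<or> l j = - 1" for j
    by (simp add: square_eq_1_iff)
  have "trace J = trace (conj_transpose U ** (U ** D))"
    unfolding JD by (rule trace_mul_sym)
  also have "\<dots> = trace D"
    by (simp add: matrix_mul_assoc unitary_cancel[OF U])
  also have "\<dots> = \<i> * of_real (\<Sum>j\<in>UNIV. l j)"
    by (simp add: trace_def D_def diagonal_def sum_distrib_left)
  also have "(\<Sum>j\<in>UNIV. l j) = (\<Sum>j\<in>UNIV. 2 * of_bool (l j = 1) - 1)"
    using l by (intro sum.cong) fastforce+
  also have "\<dots> = 2 * real (card {j. l j = 1}) - CARD('n)"
    by (simp add: sum_subtractf flip: sum_distrib_left)
  finally show ?thesis
    using that[of U l] U JD l unfolding D_def by blast
qed

text \<open>Equal traces give equal eigenvalue multiplicities. Permuting an orthonormal eigenbasis of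
  \<open>J'\<close> to match the eigenvalues of \<open>J\<close> yields the conjugating matrix.\<close>

lemma equal_trace_imp_conjugate:
  fixes J J' :: "complex^'n^'n"
  assumes J: "conj_transpose J = - J" "J ** J = - mat 1"
    and J': "conj_transpose J' = - J'" "J' ** J' = - mat 1" and tr: "trace J = trace J'"
  obtains V where "V \<in> unitary_group" "J' = V ** J ** conj_transpose V"
proof -
  obtain U l where U: "U \<in> unitary_group"
    "J = U ** diagonal (\<lambda>j. \<i> * of_real (l j)) ** conj_transpose U"
    "\<And>j. l j = 1 \<or> l j = - 1" "trace J = \<i> * of_real (2 * real (card {j. l j = 1}) - CARD('n))"
    using skew_unitary_diagonalization[OF J] by blast
  obtain U' l' where U': "U' \<in> unitary_group"
    "J' = U' ** diagonal (\<lambda>j. \<i> * of_real (l' j)) ** conj_transpose U'"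
    "\<And>j. l' j = 1 \<or> l' j = - 1" "trace J' = \<i> * of_real (2 * real (card {j. l' j = 1}) - CARD('n))"
    using skew_unitary_diagonalization[OF J'] by blast
  have card: "card {j. l j = 1} = card {j. l' j = 1}"
    using tr U(4) U'(4) by (simp add: complex_eq_iff)
  then have card': "card (- {j. l j = 1}) = card (- {j. l' j = 1})"
    by (simp add: Compl_eq_Diff_UNIV card_Diff_subset)
  obtain f where f: "bij_betw f {j. l j = 1} {j. l' j = 1}"
    using finite_same_card_bij[OF _ _ card] by auto
  obtain g where g: "bij_betw g (- {j. l j = 1}) (- {j. l' j = 1})"
    using finite_same_card_bij[OF _ _ card'] by auto
  define \<sigma> where "\<sigma> j = (if l j = 1 then f j else g j)" for j
  have "bij_betw \<sigma> ({j. l j = 1} \<union> - {j. l j = 1}) ({j. l' j = 1} \<union> - {j. l' j = 1})"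
  proof (rule bij_betw_combine)
    show "bij_betw \<sigma> {j. l j = 1} {j. l' j = 1}"
      using f by (rule bij_betw_cong[THEN iffD1, rotated]) (simp add: \<sigma>_def)
    show "bij_betw \<sigma> (- {j. l j = 1}) (- {j. l' j = 1})"
      using g by (rule bij_betw_cong[THEN iffD1, rotated]) (simp add: \<sigma>_def)
  qed auto
  then have inj: "inj \<sigma>"
    by (simp add: bij_betw_def)
  have l': "l' (\<sigma> j) = l j" for j
    using bij_betwE[OF f] bij_betwE[OF g] U(3)[of j] U'(3)[of "\<sigma> j"] by (auto simp: \<sigma>_def)
  define V where "V = (\<chi> i j. U' $ i $ \<sigma> j)"
  have col: "column j V = column (\<sigma> j) U'" for j
    by (simp add: V_def column_def vec_eq_iff)
  have "V \<in> unitary_group"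
  proof (rule unitary_if_orthonormal_columns)
    fix j k
    show "cip (column j V) (column k V) = (if j = k then 1 else 0)"
      using unitary_cancel(3)[OF U'(1)] inj
      by (simp add: col mat_def inj_eq flip: conj_transpose_mult_entry)
  qed
  have J'U': "J' ** U' = U' ** diagonal (\<lambda>j. \<i> * of_real (l' j))"
    using U'(1,2) by (simp add: unitary_mult_eq_iff)
  have "J' ** V = V ** diagonal (\<lambda>j. \<i> * of_real (l j))"
  proof (rule matrix_eq_if_columns_eq)
    fix j
    have "column j (J' ** V) = column (\<sigma> j) (J' ** U')"
      by (simp add: column_mult col)
    also have "\<dots> = column j (V ** diagonal (\<lambda>j. \<i> * of_real (l j)))"
      unfolding J'U' column_mult_diagonal col l' ..
    finally show "column j (J' ** V) = column j (V ** diagonal (\<lambda>j. \<i> * of_real (l j)))" .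
  qed
  then have "J' = V ** diagonal (\<lambda>j. \<i> * of_real (l j)) ** conj_transpose V"
    using \<open>V \<in> unitary_group\<close> by (simp add: unitary_mult_eq_iff)
  also have "\<dots> = (V ** conj_transpose U) ** J ** conj_transpose (V ** conj_transpose U)"
    by (simp add: U(2) conj_transpose_mult matrix_mul_assoc unitary_cancel[OF U(1)])
  finally show ?thesis
    by (rule that[rotated])
      (intro unitary_group_mult unitary_group_conj_transpose \<open>V \<in> unitary_group\<close> U(1))
qed

section \<open>The Cayley parametrization\<close>

text \<open>The shift by one half makes the Cayley transform act on skew-Hermitian matrices: for unitary
  \<open>C\<close> the inverse \<open>R = (1 - C)\<inverse>\<close> satisfies \<open>R + R\<^sup>* = 1\<close>.\<close>

definition resolvent :: "complex^'n^'n \<Rightarrow> complex^'n^'n"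
  where "resolvent A = matrix_inv ((1/2) *\<^sub>R mat 1 + A)"

definition cayley :: "complex^'n^'n \<Rightarrow> complex^'n^'n"
  where "cayley A = mat 1 - resolvent A"

definition cayley_inv :: "complex^'n^'n \<Rightarrow> complex^'n^'n"
  where "cayley_inv C = matrix_inv (mat 1 - C) - (1/2) *\<^sub>R mat 1"

text \<open>The real form \<open>x \<bullet> A x\<close> of a skew-Hermitian matrix vanishes, so that of \<open>1/2 + A\<close> is half the
  squared norm.\<close>

lemma det_half_plus_skew:
  fixes A :: "complex^'n^'n"
  assumes "conj_transpose A = - A"
  shows "det ((1/2) *\<^sub>R mat 1 + A) \<noteq> 0"
proof (rule det_nonzero_if_kernel_trivial)
  fix x
  assume "((1/2) *\<^sub>R mat 1 + A) *v x = 0"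
  then have "0 = x \<bullet> ((1/2) *\<^sub>R x + A *v x)"
    by (simp add: matrix_vector_mult_add_rdistrib matrix_vector_scaleR)
  also have "\<dots> = (1/2) * (x \<bullet> x)"
    by (simp add: inner_add_right inner_skew_self[OF assms])
  finally show "x = 0"
    by simp
qed

lemma resolvent_mult:
  assumes "conj_transpose A = - A"
  shows "((1/2) *\<^sub>R mat 1 + A) ** resolvent A = mat 1" "resolvent A ** ((1/2) *\<^sub>R mat 1 + A) = mat 1"
  unfolding resolvent_def by (simp_all add: matrix_inv_mult det_half_plus_skew[OF assms])

lemma det_resolvent: "conj_transpose A = - A \<Longrightarrow> det (resolvent A) \<noteq> 0"
  unfolding resolvent_def by (intro det_matrix_inv_nonzero det_half_plus_skew)

lemma unitaryI:
  fixes C :: "complex^'n^'n"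
  assumes "C ** conj_transpose C = mat 1"
  shows "C \<in> unitary_group"
  using assms matrix_left_right_inverse[of C "conj_transpose C"] by (simp add: unitary_group_def)

text \<open>With \<open>R = 1/2 + A\<close> and \<open>S = R\<inverse>\<close>, the relation \<open>R + R\<^sup>* = 1\<close> turns into \<open>S + S\<^sup>* = S S\<^sup>*\<close>,
  which says that \<open>1 - S\<close> is unitary.\<close>

lemma cayley_in_E_set:
  fixes A :: "complex^'n^'n"
  assumes A: "conj_transpose A = - A"
  shows "cayley A \<in> E_set"
proof -
  define R where "R = (1/2) *\<^sub>R mat 1 + A"
  define S where "S = resolvent A"
  have SR: "S ** R = mat 1"
    unfolding S_def R_def by (rule resolvent_mult[OF A])
  have "conj_transpose (S ** R) = mat 1"
    by (simp add: SR conj_transpose_mat)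
  then have RS: "conj_transpose R ** conj_transpose S = mat 1"
    using matrix_left_right_inverse by (auto simp: conj_transpose_mult)
  have "R + conj_transpose R = mat 1"
    by (simp add: R_def conj_transpose_simps A flip: scaleR_add_left)
  then have "S ** conj_transpose S = S ** (R + conj_transpose R) ** conj_transpose S"
    by simp
  also have "\<dots> = (S ** R) ** conj_transpose S + S ** (conj_transpose R ** conj_transpose S)"
    by (simp add: matrix_ring_simps matrix_mul_assoc)
  also have "\<dots> = conj_transpose S + S"
    by (simp add: SR RS)
  finally have "S ** conj_transpose S = conj_transpose S + S" .
  then have "(mat 1 - S) ** conj_transpose (mat 1 - S) = mat 1"
    by (simp add: conj_transpose_simps matrix_ring_simps)
  moreover have "det ((mat 1 - S) - mat 1) \<noteq> 0"
    using det_resolvent[OF A] det_uminus_nonzero_iff[of S] by (simp add: S_def)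
  ultimately show ?thesis
    unfolding E_set_def cayley_def S_def by (simp add: unitaryI)
qed

lemma E_set_det:
  fixes C :: "complex^'n^'n"
  assumes "C \<in> E_set"
  shows "det (mat 1 - C) \<noteq> 0"
proof -
  have "mat 1 - C = - (C - mat 1)"
    by simp
  then show ?thesis
    using assms by (simp only: det_uminus_nonzero_iff) (simp add: E_set_def)
qed

text \<open>The computation for the direct transform run backwards: unitarity of \<open>C\<close> says
  \<open>M + M\<^sup>* = M M\<^sup>*\<close> for \<open>M = 1 - C\<close>, and multiplying by the inverses gives \<open>R + R\<^sup>* = 1\<close>.\<close>

lemma cayley_inv_skew:
  fixes C :: "complex^'n^'n"
  assumes C: "C \<in> E_set"
  shows "conj_transpose (cayley_inv C) = - cayley_inv C"
proof -
  define M where "M = mat 1 - C"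
  define R where "R = matrix_inv M"
  have RM: "R ** M = mat 1"
    unfolding R_def M_def by (rule matrix_inv_mult[OF E_set_det[OF C]])
  have "conj_transpose (R ** M) = mat 1"
    by (simp add: RM conj_transpose_mat)
  then have MR: "conj_transpose M ** conj_transpose R = mat 1"
    by (simp add: conj_transpose_mult)
  have "C ** conj_transpose C = mat 1"
    using C by (simp add: E_set_def unitary_group_def)
  then have "M + conj_transpose M = M ** conj_transpose M"
    by (simp add: M_def conj_transpose_simps matrix_ring_simps)
  then have "R ** (M + conj_transpose M) ** conj_transpose R =
      (R ** M) ** (conj_transpose M ** conj_transpose R)"
    by (simp add: matrix_mul_assoc)
  moreover have "R ** (M + conj_transpose M) ** conj_transpose R =
      (R ** M) ** conj_transpose R + R ** (conj_transpose M ** conj_transpose R)"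
    by (simp add: matrix_ring_simps matrix_mul_assoc)
  ultimately have "conj_transpose R + R = mat 1"
    by (simp add: RM MR)
  then have "conj_transpose R = mat 1 - R"
    by (simp add: eq_diff_eq)
  moreover have "(mat 1 :: complex^'n^'n) = (1/2) *\<^sub>R mat 1 + (1/2) *\<^sub>R mat 1"
    by (simp flip: scaleR_add_left)
  ultimately show ?thesis
    unfolding cayley_inv_def R_def[symmetric] M_def[symmetric]
    by (simp add: conj_transpose_simps)
qed

lemma cayley_cayley_inv:
  assumes "C \<in> E_set"
  shows "cayley (cayley_inv C) = C"
proof -
  have "matrix_inv (matrix_inv (mat 1 - C)) = mat 1 - C"
    by (intro matrix_inv_unique matrix_inv_mult E_set_det assms)
  then show ?thesis
    by (simp add: cayley_def cayley_inv_def resolvent_def)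
qed

lemma cayley_conjugate:
  assumes A: "conj_transpose A = - A" and U: "U \<in> unitary_group"
  shows "cayley (U ** A ** conj_transpose U) = U ** cayley A ** conj_transpose U"
proof -
  have half: "(1/2) *\<^sub>R mat 1 + U ** A ** conj_transpose U =
      U ** ((1/2) *\<^sub>R mat 1 + A) ** conj_transpose U"
    by (simp add: matrix_ring_simps unitary_cancel[OF U])
  have "(U ** ((1/2) *\<^sub>R mat 1 + A) ** conj_transpose U) ** (U ** resolvent A ** conj_transpose U) =
      U ** (((1/2) *\<^sub>R mat 1 + A) ** resolvent A) ** conj_transpose U"
    by (simp only: matrix_mul_assoc unitary_cancel[OF U])
  also have "\<dots> = mat 1"
    by (simp add: resolvent_mult[OF A] unitary_cancel[OF U])
  finally have "resolvent (U ** A ** conj_transpose U) = U ** resolvent A ** conj_transpose U"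
    unfolding resolvent_def half by (rule matrix_inv_unique)
  then show ?thesis
    by (simp add: cayley_def matrix_ring_simps unitary_cancel[OF U])
qed

lemma cayley_inv_conjugate:
  assumes C: "C \<in> E_set" and U: "U \<in> unitary_group"
  shows "cayley_inv (U ** C ** conj_transpose U) = U ** cayley_inv C ** conj_transpose U"
proof -
  have eq: "mat 1 - U ** C ** conj_transpose U = U ** (mat 1 - C) ** conj_transpose U"
    by (simp add: matrix_ring_simps unitary_cancel[OF U])
  have "(U ** (mat 1 - C) ** conj_transpose U) ** (U ** matrix_inv (mat 1 - C) ** conj_transpose U) =
      U ** ((mat 1 - C) ** matrix_inv (mat 1 - C)) ** conj_transpose U"
    by (simp only: matrix_mul_assoc unitary_cancel[OF U])
  also have "\<dots> = mat 1"
    by (simp add: matrix_inv_mult[OF E_set_det[OF C]] unitary_cancel[OF U])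
  finally have "matrix_inv (mat 1 - U ** C ** conj_transpose U) =
      U ** matrix_inv (mat 1 - C) ** conj_transpose U"
    unfolding eq by (rule matrix_inv_unique)
  then show ?thesis
    by (simp add: cayley_inv_def matrix_ring_simps unitary_cancel[OF U])
qed

text \<open>This identity decides whether the third boundary matrix has eigenvalue 1. It holds because
  \<open>A + B\<close> is the sum of the two shifted matrices minus the identity.\<close>

lemma one_minus_cayley_product:
  assumes A: "conj_transpose A = - A" and B: "conj_transpose B = - B"
  shows "mat 1 - cayley A ** cayley B = resolvent A ** (A + B) ** resolvent B"
proof -
  define Q where "Q = (1/2) *\<^sub>R (mat 1 :: complex^'a^'a)"
  have QQ: "Q + Q = mat 1"
    by (simp add: Q_def flip: scaleR_add_left)
  have "resolvent A ** (A + B) ** resolvent B =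
      resolvent A ** ((Q + A) + (Q + B) - mat 1) ** resolvent B"
    by (simp flip: QQ)
  also have "\<dots> = (resolvent A ** (Q + A)) ** resolvent B + resolvent A ** ((Q + B) ** resolvent B)
      - resolvent A ** resolvent B"
    by (simp only: matrix_ring_simps matrix_mul_assoc matrix_mul_rid)
  also have "\<dots> = resolvent B + resolvent A - resolvent A ** resolvent B"
    unfolding Q_def by (simp only: resolvent_mult[OF A] resolvent_mult[OF B] matrix_mul_lid matrix_mul_rid)
  finally show ?thesis
    by (simp add: cayley_def matrix_ring_simps)
qed

text \<open>The parameters of a triple are the Cayley parameter of \<open>C\<^sub>1\<close> and the sum of those of \<open>C\<^sub>1\<close>
  and \<open>C\<^sub>2\<close>; taking the sum as a coordinate makes the conditions on the two parameters
  independent.\<close>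

definition triple_of where
  "triple_of A N = (cayley A, cayley (N - A), conj_transpose (cayley A ** cayley (N - A)))"

definition first_param where "first_param x = cayley_inv (fst x)"

definition sum_param where "sum_param x = cayley_inv (fst x) + cayley_inv (fst (snd x))"

lemma triple_of_in_S03:
  assumes A: "conj_transpose A = - A" and N: "N \<in> invertible_skew"
  shows "triple_of A N \<in> S03"
proof -
  have B: "conj_transpose (N - A) = - (N - A)"
    using A N by (simp add: invertible_skew_def conj_transpose_simps)
  define C where "C = cayley A ** cayley (N - A)"
  have E: "cayley A \<in> E_set" "cayley (N - A) \<in> E_set"
    using A B by (simp_all add: cayley_in_E_set)
  then have C: "C \<in> unitary_group"
    unfolding C_def E_set_def by (auto intro: unitary_group_mult)
  have "conj_transpose C - mat 1 = conj_transpose C ** (mat 1 - C)"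
    by (simp add: matrix_ring_simps unitary_cancel[OF C])
  moreover have "det (mat 1 - C) \<noteq> 0"
    unfolding C_def one_minus_cayley_product[OF A B]
    using N det_resolvent[OF A] det_resolvent[OF B] by (simp add: det_mul invertible_skew_def)
  moreover have "det (conj_transpose C) * det C = 1"
    by (metis unitary_cancel(3)[OF C] det_I det_mul)
  ultimately have "conj_transpose C \<in> E_set"
    using unitary_group_conj_transpose[OF C] by (auto simp: E_set_def det_mul)
  with E show ?thesis
    by (simp add: S03_def triple_of_def C_def[symmetric] unitary_cancel[OF C])
qed

lemma S03_params:
  assumes x: "x \<in> S03"
  shows "conj_transpose (first_param x) = - first_param x" "sum_param x \<in> invertible_skew"
    "triple_of (first_param x) (sum_param x) = x"
proof -
  obtain C1 C2 C3 where xeq: "x = (C1, C2, C3)"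
    by (cases x)
  have E: "C1 \<in> E_set" "C2 \<in> E_set" "C3 \<in> E_set" and prod: "C1 ** C2 ** C3 = mat 1"
    using x by (auto simp: xeq S03_def)
  define A where "A = cayley_inv C1"
  define B where "B = cayley_inv C2"
  have A: "conj_transpose A = - A" and B: "conj_transpose B = - B"
    using E by (simp_all add: A_def B_def cayley_inv_skew)
  have AC: "cayley A = C1" and BC: "cayley B = C2"
    using E by (simp_all add: A_def B_def cayley_cayley_inv)
  have "C1 ** C2 \<in> unitary_group"
    using E by (auto simp: E_set_def intro: unitary_group_mult)
  then have C3: "C3 = conj_transpose (C1 ** C2)"
    using prod by (metis matrix_mul_assoc matrix_mul_lid matrix_mul_rid unitary_cancel(3))
  have "C3 - mat 1 = C3 ** (mat 1 - C1 ** C2)"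
    using matrix_left_right_inverse[of "C1 ** C2" C3] prod by (simp add: matrix_ring_simps)
  then have "C3 - mat 1 = C3 ** (resolvent A ** (A + B) ** resolvent B)"
    using one_minus_cayley_product[OF A B] AC BC by simp
  then have "det (A + B) \<noteq> 0"
    using E(3) by (auto simp: E_set_def det_mul)
  then show "sum_param x \<in> invertible_skew"
    using A B by (simp add: sum_param_def xeq invertible_skew_def conj_transpose_simps
        flip: A_def B_def)
  show "conj_transpose (first_param x) = - first_param x"
    using A by (simp add: first_param_def xeq flip: A_def)
  show "triple_of (first_param x) (sum_param x) = x"
    using AC BC C3 by (simp add: triple_of_def first_param_def sum_param_def xeq
        flip: A_def B_def)
qed

lemma triple_of_conjugate:
  assumes A: "conj_transpose A = - A" and N: "N \<in> invertible_skew" and U: "U \<in> unitary_group"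
  shows "triple_of (U ** A ** conj_transpose U) (U ** N ** conj_transpose U) =
    conj_act U (triple_of A N)"
proof -
  have B: "conj_transpose (N - A) = - (N - A)"
    using A N by (simp add: invertible_skew_def conj_transpose_simps)
  have "U ** N ** conj_transpose U - U ** A ** conj_transpose U = U ** (N - A) ** conj_transpose U"
    by (simp add: matrix_ring_simps)
  then show ?thesis
    by (simp add: triple_of_def conj_act_def cayley_conjugate[OF A U] cayley_conjugate[OF B U]
        conj_transpose_mult matrix_mul_assoc unitary_cancel[OF U])
qed

lemma params_conjugate:
  assumes x: "x \<in> S03" and U: "U \<in> unitary_group"
  shows "first_param (conj_act U x) = U ** first_param x ** conj_transpose U"
    "sum_param (conj_act U x) = U ** sum_param x ** conj_transpose U"
  using x by (auto simp: S03_def first_param_def sum_param_def conj_act_def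
      cayley_inv_conjugate[OF _ U] matrix_ring_simps)

lemma continuous_on_cayley [continuous_intros]:
  assumes "continuous_on S f" "\<And>x. x \<in> S \<Longrightarrow> conj_transpose (f x) = - f x"
  shows "continuous_on S (\<lambda>x. cayley (f x))"
  unfolding cayley_def resolvent_def
  using assms det_half_plus_skew by (intro continuous_intros) auto

lemma continuous_on_cayley_inv [continuous_intros]:
  assumes "continuous_on S f" "\<And>x. x \<in> S \<Longrightarrow> f x \<in> E_set"
  shows "continuous_on S (\<lambda>x. cayley_inv (f x))"
  unfolding cayley_inv_def
  using assms E_set_det by (intro continuous_intros) auto

lemma continuous_on_triple_of:
  assumes f: "continuous_on S f" and g: "continuous_on S g"
    and A: "\<And>x. x \<in> S \<Longrightarrow> conj_transpose (f x) = - f x" and N: "\<And>x. x \<in> S \<Longrightarrow> g x \<in> invertible_skew"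
  shows "continuous_on S (\<lambda>x. triple_of (f x) (g x))"
proof -
  have "conj_transpose (g x - f x) = - (g x - f x)" if "x \<in> S" for x
    using A[OF that] N[OF that] by (simp add: invertible_skew_def conj_transpose_simps)
  then show ?thesis
    unfolding triple_of_def using f g A by (intro continuous_intros) auto
qed

lemma continuous_on_first_param: "continuous_on S03 first_param"
  unfolding first_param_def by (intro continuous_intros) (auto simp: S03_def)

lemma continuous_on_sum_param: "continuous_on S03 sum_param"
  unfolding sum_param_def by (intro continuous_intros) (auto simp: S03_def)

lemma continuous_on_phase_sum_param: "continuous_on S03 (\<lambda>x. phase (sum_param x))"
  by (rule continuous_on_compose2[OF continuous_on_phase continuous_on_sum_param])
    (auto simp: S03_params)

section \<open>The equivariant deformation\<close>

definition deform :: "real \<times> (complex^'p^'p) \<times> (complex^'p^'p) \<times> (complex^'p^'p) \<Rightarrow>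
    (complex^'p^'p) \<times> (complex^'p^'p) \<times> (complex^'p^'p)"
  where "deform = (\<lambda>(t, x). triple_of ((1 - t) *\<^sub>R first_param x)
    ((1 - t) *\<^sub>R sum_param x + t *\<^sub>R phase (sum_param x)))"

lemma deform_params:
  assumes "x \<in> S03" "0 \<le> t" "t \<le> 1"
  shows "conj_transpose ((1 - t) *\<^sub>R first_param x) = - ((1 - t) *\<^sub>R first_param x)"
    "(1 - t) *\<^sub>R sum_param x + t *\<^sub>R phase (sum_param x) \<in> invertible_skew"
  using assms by (simp_all add: S03_params conj_transpose_simps segment_to_phase_invertible)

lemma deform_in_S03: "x \<in> S03 \<Longrightarrow> 0 \<le> t \<Longrightarrow> t \<le> 1 \<Longrightarrow> deform (t, x) \<in> S03"
  unfolding deform_def prod.case by (intro triple_of_in_S03 deform_params)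

lemma continuous_on_deform:
  "continuous_on ({0..1} \<times> (S03 :: (_ \<times> _ \<times> (complex^'p^'p)) set)) deform"
proof -
  have snd: "continuous_on ({0..1} \<times> S03) (\<lambda>z. p (snd z))" if "continuous_on S03 p"
    for p :: "_ \<times> _ \<times> (complex^'p^'p) \<Rightarrow> complex^'p^'p"
    by (rule continuous_on_compose2[OF that continuous_on_snd[OF continuous_on_id]]) auto
  have "continuous_on ({0..1} \<times> S03) (\<lambda>z. triple_of ((1 - fst z) *\<^sub>R first_param (snd z))
    ((1 - fst z) *\<^sub>R sum_param (snd z) + fst z *\<^sub>R phase (sum_param (snd z :: _ \<times> _ \<times> (complex^'p^'p)))))"
    by (intro continuous_on_triple_of continuous_intros snd continuous_on_first_param
        continuous_on_sum_param continuous_on_phase_sum_param)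
      (auto simp: deform_params)
  then show ?thesis
    by (simp add: deform_def case_prod_unfold)
qed

lemma deform_0: "x \<in> S03 \<Longrightarrow> deform (0, x) = x"
  by (simp add: deform_def S03_params)

lemma deform_conjugate:
  assumes x: "x \<in> S03" and t: "0 \<le> t" "t \<le> 1" and U: "U \<in> unitary_group"
  shows "deform (t, conj_act U x) = conj_act U (deform (t, x))"
proof -
  have "(1 - t) *\<^sub>R first_param (conj_act U x) =
      U ** ((1 - t) *\<^sub>R first_param x) ** conj_transpose U"
    by (simp add: params_conjugate[OF x U] matrix_ring_simps)
  moreover have "(1 - t) *\<^sub>R sum_param (conj_act U x) + t *\<^sub>R phase (sum_param (conj_act U x)) =
      U ** ((1 - t) *\<^sub>R sum_param x + t *\<^sub>R phase (sum_param x)) ** conj_transpose U"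
    by (simp add: params_conjugate[OF x U] phase_conjugate[OF S03_params(2)[OF x] U]
        matrix_ring_simps)
  ultimately show ?thesis
    unfolding deform_def prod.case
    by (simp only: triple_of_conjugate[OF deform_params[OF x t] U])
qed

text \<open>The trace of the phase equals \<open>\<i>\<close> times the signature of the Hermitian matrix \<open>- \<i> N\<close>.\<close>

definition signature :: "(complex^'p^'p) \<times> (complex^'p^'p) \<times> (complex^'p^'p) \<Rightarrow> complex"
  where "signature x = trace (phase (sum_param x))"

lemma phase_sum_param:
  assumes "x \<in> S03"
  shows "conj_transpose (phase (sum_param x)) = - phase (sum_param x)"
    "phase (sum_param x) ** phase (sum_param x) = - mat 1"
  using is_phase_phase[OF S03_params(2)[OF assms]] unfolding is_phase_def by simp_all

lemma signature_conjugate: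
  assumes x: "x \<in> S03" and U: "U \<in> unitary_group"
  shows "signature (conj_act U x) = signature x"
proof -
  have "signature (conj_act U x) = trace (conj_transpose U ** (U ** phase (sum_param x)))"
    unfolding signature_def params_conjugate[OF x U] phase_conjugate[OF S03_params(2)[OF x] U]
    by (rule trace_mul_sym)
  then show ?thesis
    by (simp add: signature_def matrix_mul_assoc unitary_cancel[OF U])
qed

text \<open>The trace of a phase is fixed by the multiplicity of \<open>\<i>\<close>, which lies between 0 and the size
  of the matrix.\<close>

lemma finite_signatures: "finite (signature ` (S03 :: ((complex^'p^'p) \<times> _) set))"
proof (rule finite_subset)
  show "signature ` (S03 :: ((complex^'p^'p) \<times> _) set) \<subseteq>
      (\<lambda>k. \<i> * of_real (2 * real k - CARD('p))) ` {..CARD('p)}"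
  proof
    fix s
    assume "s \<in> signature ` (S03 :: ((complex^'p^'p) \<times> _) set)"
    then obtain x :: "(complex^'p^'p) \<times> (complex^'p^'p) \<times> (complex^'p^'p)"
      where x: "x \<in> S03" "s = signature x"
      by blast
    obtain U l where "s = \<i> * of_real (2 * real (card {j::'p. l j = (1::real)}) - CARD('p))"
      using skew_unitary_diagonalization[OF phase_sum_param[OF x(1)]] x(2)
      unfolding signature_def by metis
    moreover have "card {j::'p. l j = 1} \<le> CARD('p)"
      by (simp add: card_mono)
    ultimately show "s \<in> (\<lambda>k. \<i> * of_real (2 * real k - CARD('p))) ` {..CARD('p)}"
      by blast
  qed
qed simp

lemma conj_orbit_conj_act:
  fixes U :: "complex^'p^'p"
  assumes U: "U \<in> unitary_group"
  shows "conj_orbit (conj_act U x) = conj_orbit x"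
proof -
  have mult: "conj_act V (conj_act W y) = conj_act (V ** W) y" for V W :: "complex^'p^'p" and y
    by (simp add: conj_act_def conj_transpose_mult matrix_mul_assoc split: prod.split)
  have one: "conj_act (mat 1) y = y" for y :: "_ \<times> _ \<times> (complex^'p^'p)"
    by (simp add: conj_act_def conj_transpose_mat split: prod.split)
  have sub: "conj_orbit (conj_act W y) \<subseteq> conj_orbit y" if "W \<in> unitary_group"
    for W :: "complex^'p^'p" and y
    using that unfolding conj_orbit_def by (auto simp: mult intro: unitary_group_mult)
  have "conj_act (conj_transpose U) (conj_act U x) = x"
    by (simp add: mult one unitary_cancel[OF U])
  then have "conj_orbit x \<subseteq> conj_orbit (conj_act U x)"
    using sub[OF unitary_group_conj_transpose[OF U], of "conj_act U x"] by simp
  then show ?thesis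
    using sub[OF U, of x] by blast
qed

lemma conj_orbit_eqE:
  assumes "conj_orbit x = conj_orbit y"
  obtains U where "U \<in> unitary_group" "y = conj_act U x"
proof -
  have "y = conj_act (mat 1) y"
    by (simp add: conj_act_def conj_transpose_mat split: prod.split)
  moreover have "mat 1 \<in> unitary_group"
    by (simp add: unitary_group_def conj_transpose_mat)
  ultimately have "y \<in> conj_orbit y"
    unfolding conj_orbit_def by blast
  then show ?thesis
    using that assms unfolding conj_orbit_def by blast
qed

text \<open>At time 1 the first parameter is 0, so the triple is determined by the phase, and the phase
  up to conjugation by its trace.\<close>

lemma equal_signature_imp_same_final_orbit:
  assumes x: "x \<in> S03" and y: "y \<in> S03" and eq: "signature x = signature y"
  shows "conj_orbit (deform (1, x)) = conj_orbit (deform (1, y))"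
proof -
  obtain V where V: "V \<in> unitary_group"
    "phase (sum_param y) = V ** phase (sum_param x) ** conj_transpose V"
    using equal_trace_imp_conjugate[OF phase_sum_param[OF x] phase_sum_param[OF y]] eq
    unfolding signature_def by blast
  have "phase (sum_param x) \<in> invertible_skew"
    using deform_params(2)[OF x, of 1] by simp
  then have "triple_of (V ** 0 ** conj_transpose V) (phase (sum_param y)) =
      conj_act V (triple_of 0 (phase (sum_param x)))"
    unfolding V(2) by (intro triple_of_conjugate V(1)) (simp add: conj_transpose_def transpose_def vec_eq_iff)
  moreover have "V ** 0 ** conj_transpose V = 0"
    by (simp add: matrix_matrix_mult_def vec_eq_iff)
  ultimately have "deform (1, y) = conj_act V (deform (1, x))"
    by (simp add: deform_def)
  then show ?thesis
    using conj_orbit_conj_act[OF V(1)] by simp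
qed

section \<open>Deformations that descend to a quotient\<close>

text \<open>Because the unit interval is locally compact, the product of a quotient map with the
  identity of the interval is again a quotient map, so a deformation compatible with the fibres
  descends to the quotient. Paths traced by the deformation stay in their component, and the
  finite-valued invariant is constant on a component; hence the end of the deformation is a single
  point there.\<close>

lemma contractible_component_of_quotient:
  fixes f :: "'a \<Rightarrow> 'c::metric_space"
  assumes q: "quotient_map X Y q"
    and h: "continuous_map (prod_topology (top_of_set {0..1::real}) X) X h"
    and h_inv: "\<And>t x y. \<lbrakk>t \<in> {0..1}; x \<in> topspace X; y \<in> topspace X; q x = q y\<rbrakk>
        \<Longrightarrow> q (h (t, x)) = q (h (t, y))"
    and h0: "\<And>x. x \<in> topspace X \<Longrightarrow> q (h (0, x)) = q x"
    and f: "continuous_map X euclidean f"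
    and f_inv: "\<And>x y. \<lbrakk>x \<in> topspace X; y \<in> topspace X; q x = q y\<rbrakk> \<Longrightarrow> f x = f y"
    and fin: "finite (f ` topspace X)"
    and h1: "\<And>x y. \<lbrakk>x \<in> topspace X; y \<in> topspace X; f x = f y\<rbrakk> \<Longrightarrow> q (h (1, x)) = q (h (1, y))"
    and K: "K \<in> connected_components_of Y"
  shows "contractible_space (subtopology Y K)"
proof -
  let ?I = "top_of_set {0..1::real}"
  have surj: "q ` topspace X = topspace Y"
    using q by (rule quotient_imp_surjective_map)
  have "locally_compact_space ?I"
    by (intro compact_imp_locally_compact_space Hausdorff_space_subtopology disjI1)
      (simp_all add: compact_space_subtopology)
  moreover have "Hausdorff_space ?I"
    by (simp add: Hausdorff_space_subtopology)
  ultimately have qI: "quotient_map (prod_topology ?I X) (prod_topology ?I Y) (map_prod id q)"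
    using quotient_map_prod_right[OF _ _ q, of ?I] by (simp add: map_prod_def id_def)
  have "continuous_map (prod_topology ?I X) Y (q \<circ> h)"
    using h quotient_imp_continuous_map[OF q] by (rule continuous_map_compose)
  moreover have "(q \<circ> h) z = (q \<circ> h) w"
    if "z \<in> topspace (prod_topology ?I X)" "w \<in> topspace (prod_topology ?I X)"
      "map_prod id q z = map_prod id q w" for z w
  proof -
    obtain t x u y where zw: "z = (t, x)" "w = (u, y)"
      by (cases z, cases w)
    then have "u = t" "t \<in> {0..1}" "x \<in> topspace X" "y \<in> topspace X" "q x = q y"
      using that by auto
    then show ?thesis
      unfolding zw comp_def by (metis h_inv)
  qed
  ultimately have "\<exists>g. continuous_map (prod_topology ?I Y) Y g \<and>
      (\<forall>z \<in> topspace (prod_topology ?I X). g (map_prod id q z) = (q \<circ> h) z)"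
    by (rule quotient_map_lift_exists[OF qI]) auto
  then obtain g where g: "continuous_map (prod_topology ?I Y) Y g"
    and gq: "\<And>z. z \<in> topspace (prod_topology ?I X) \<Longrightarrow> g (map_prod id q z) = (q \<circ> h) z"
    by blast
  have "\<exists>F. continuous_map Y euclidean F \<and> (\<forall>x \<in> topspace X. F (q x) = f x)"
    by (rule quotient_map_lift_exists[OF q f]) (blast intro: f_inv)+
  then obtain F where F: "continuous_map Y euclidean F"
    and Fq: "\<And>x. x \<in> topspace X \<Longrightarrow> F (q x) = f x"
    by blast
  have gq': "g (t, q x) = q (h (t, x))" if "t \<in> {0..1}" "x \<in> topspace X" for t x
    using gq[of "(t, x)"] that by simp
  have KY: "K \<subseteq> topspace Y" and conn: "connectedin Y K"
    using K connected_components_of_subset connectedin_connected_components_of by blast+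
  have lift: "\<exists>x \<in> topspace X. y = q x" if "y \<in> K" for y
  proof -
    have "y \<in> q ` topspace X"
      using that KY surj by auto
    then show ?thesis
      by auto
  qed
  have g0: "g (0, y) = y" if y: "y \<in> K" for y
  proof -
    obtain x where "x \<in> topspace X" "y = q x"
      using lift[OF y] by blast
    then show ?thesis
      by (simp add: gq' h0)
  qed
  have gK: "g (t, y) \<in> K" if t: "t \<in> {0..1}" and y: "y \<in> K" for t y
  proof -
    have "continuous_map ?I (prod_topology ?I Y) (\<lambda>t. (t, y))"
      using y KY by (auto simp: continuous_map_pairwise o_def)
    then have "continuous_map ?I Y (g \<circ> (\<lambda>t. (t, y)))"
      using g by (rule continuous_map_compose)
    moreover have "connectedin ?I {0..1}"
      by (simp add: connectedin_subtopology)
    ultimately have "connectedin Y ((g \<circ> (\<lambda>t. (t, y))) ` {0..1})"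
      by (rule connectedin_continuous_map_image)
    moreover have "y \<in> (g \<circ> (\<lambda>t. (t, y))) ` {0..1}"
      using g0[OF y] by (force intro: image_eqI[of _ _ 0])
    ultimately have "(g \<circ> (\<lambda>t. (t, y))) ` {0..1} \<subseteq> K"
      using connected_components_of_maximal[OF K] y by (auto simp: disjnt_iff)
    with t show ?thesis
      by auto
  qed
  have "connected (F ` K)"
    using connectedin_continuous_map_image[OF F conn] by simp
  moreover have "F ` K \<subseteq> f ` topspace X"
    using lift Fq by fastforce
  then have "finite (F ` K)"
    using fin finite_subset by blast
  ultimately obtain c where c: "\<And>y. y \<in> K \<Longrightarrow> F y = c"
    using connected_finite_iff_sing[of "F ` K"] by (metis empty_iff imageI singletonD)
  obtain k where k: "k \<in> K"
    using K nonempty_connected_components_of by blast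
  have g1: "g (1, y) = g (1, k)" if y: "y \<in> K" for y
  proof -
    obtain x where x: "x \<in> topspace X" "y = q x"
      using lift[OF y] by blast
    obtain x' where x': "x' \<in> topspace X" "k = q x'"
      using lift[OF k] by blast
    have "f x = f x'"
      using c[OF y] c[OF k] Fq x x' by simp
    then show ?thesis
      using h1[OF x(1) x'(1)] x x' by (simp add: gq')
  qed
  have "continuous_map (prod_topology ?I (subtopology Y K)) (subtopology Y K) g"
    using gK KY g
    by (auto simp: continuous_map_in_subtopology prod_topology_subtopology(2)
        intro: continuous_map_from_subtopology)
  then have "homotopic_with (\<lambda>x. True) (subtopology Y K) (subtopology Y K) id (\<lambda>x. g (1, k))"
    using g0 g1 by (subst homotopic_with) (auto intro!: exI[of _ g])
  then show ?thesis
    unfolding contractible_space_def by blast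
qed

section \<open>Contractibility of the components\<close>

theorem corollary3p4:
  fixes K :: "((complex^'p^'p) \<times> (complex^'p^'p) \<times> (complex^'p^'p)) set set"
  assumes "K \<in> connected_components_of S03_mod_U"
  shows "contractible_space (subtopology S03_mod_U K)"
proof (rule contractible_component_of_quotient)
  let ?S = "S03 :: ((complex^'p^'p) \<times> (complex^'p^'p) \<times> (complex^'p^'p)) set"
  show "quotient_map (top_of_set ?S) S03_mod_U conj_orbit"
    unfolding S03_mod_U_def by (rule quotient_map_quotient_topology)
  show "continuous_map (prod_topology (top_of_set {0..1}) (top_of_set ?S)) (top_of_set ?S) deform"
    using continuous_on_deform deform_in_S03 by auto
  show "continuous_map (top_of_set ?S) euclidean signature"
    unfolding signature_def using continuous_on_trace[OF continuous_on_phase_sum_param] by simp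
  show "finite (signature ` topspace (top_of_set ?S))"
    using finite_signatures by simp
  fix t :: real and x y :: "(complex^'p^'p) \<times> (complex^'p^'p) \<times> (complex^'p^'p)"
  assume x: "x \<in> topspace (top_of_set ?S)" and y: "y \<in> topspace (top_of_set ?S)"
  show "conj_orbit (deform (0, x)) = conj_orbit x"
    using x by (simp add: deform_0)
  show "conj_orbit (deform (1, x)) = conj_orbit (deform (1, y))" if "signature x = signature y"
    using x y that by (intro equal_signature_imp_same_final_orbit) auto
  assume "conj_orbit x = conj_orbit y"
  then obtain U where U: "U \<in> unitary_group" "y = conj_act U x"
    by (rule conj_orbit_eqE)
  show "signature x = signature y"
    using x U by (simp add: signature_conjugate)
  show "conj_orbit (deform (t, x)) = conj_orbit (deform (t, y))" if "t \<in> {0..1}"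
    using x U that by (simp add: deform_conjugate conj_orbit_conj_act)
qed (rule assms)

end
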